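(* Let $\mathcal H$ be a CNP space on a set $X$, with kernel $k$. If $T$ is a densely defined operator in $\mathcal H$, affiliated to $\mathrm{Mult}(\mathcal H)$, then there exists a function $h:X\to\mathbb C$ such that for every $f\in \mathrm{Dom}\,T$, $(Tf)(x)=h(x)f(x)$ for all $x\in X$. Moreover there exist nonzero multipliers $a,b\in\mathrm{Mult}(\mathcal H)$ such that $b(x)=a(x)h(x)$ for all $x\in X$.
   Context: A CNP kernel on a set $X$ is a kernel of the form $k(x,y)=\frac{1}{1-\langle u(x),u(y)\rangle}$ where $u:X\to \ell^2(I)$ is injective ($I$ some index set) and $\|u(x)\|<1$ for all $x\in X$. A CNP space on $X$ is the reproducing kernel Hilbert space $\mathcal H$ of complex-valued functions on $X$ with such a kernel $k$. $\mathrm{Mult}(\mathcal H)$ is the algebra of multipliers of $\mathcal H$, i.e. functions $\varphi:X\to\mathbb C$ with $\varphi f\in\mathcal H$ for all $f\in\mathcal H$ (the operator $M_\varphi f=\varphi f$ is then bounded). A densely defined operator $T$ in $\mathcal H$ is a linear map $T:\mathrm{Dom}\,T\to\mathcal H$ with $\mathrm{Dom}\,T$ a dense linear subspace of $\mathcal H$. It is affiliated to $\mathrm{Mult}(\mathcal H)$ if whenever $f\in\mathrm{Dom}\,T$ and $\varphi\in\mathrm{Mult}(\mathcal H)$, then $\varphi f\in \mathrm{Dom}\,T$ and $T(\varphi f)=\varphi\cdot(Tf)$.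
   Formalization: The multiplier b is claimed to be nonzero only when T is not the zero operator; for T = 0 one has h = 0, so b = ah = 0 and the claim as stated fails. *)

theory Defs
  imports "HOL-Analysis.Analysis" "HOL-Library.Function_Algebras"
begin

text \<open>
  The underlying set of the function spaces is a type \<open>'x\<close>; in particular it is nonempty.
  Sums, differences, products and \<open>0\<close> of functions are pointwise.
\<close>

definition fun_scale :: "complex \<Rightarrow> ('x \<Rightarrow> complex) \<Rightarrow> 'x \<Rightarrow> complex" where
  "fun_scale c f = (\<lambda>x. c * f x)"

interpretation fun_vs: vector_space "fun_scale :: complex \<Rightarrow> ('x \<Rightarrow> complex) \<Rightarrow> 'x \<Rightarrow> complex"
  by unfold_locales (auto simp: fun_scale_def fun_eq_iff algebra_simps)

definition ell2 :: "('i \<Rightarrow> complex) set" where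
  "ell2 = {v. (\<lambda>i. (cmod (v i))\<^sup>2) summable_on UNIV}"

definition ell2_inner :: "('i \<Rightarrow> complex) \<Rightarrow> ('i \<Rightarrow> complex) \<Rightarrow> complex" where
  "ell2_inner v w = (\<Sum>\<^sub>\<infinity>i. v i * cnj (w i))"

definition ell2_norm :: "('i \<Rightarrow> complex) \<Rightarrow> real" where
  "ell2_norm v = sqrt (\<Sum>\<^sub>\<infinity>i. (cmod (v i))\<^sup>2)"

definition cnp_kernel :: "('x \<Rightarrow> 'i \<Rightarrow> complex) \<Rightarrow> ('x \<Rightarrow> 'x \<Rightarrow> complex) \<Rightarrow> bool" where
  "cnp_kernel u k \<longleftrightarrow>
     inj u \<and> (\<forall>x. u x \<in> ell2 \<and> ell2_norm (u x) < 1) \<and>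
     (\<forall>x y. k x y = 1 / (1 - ell2_inner (u x) (u y)))"

definition ip_norm :: "(('x \<Rightarrow> complex) \<Rightarrow> ('x \<Rightarrow> complex) \<Rightarrow> complex) \<Rightarrow> ('x \<Rightarrow> complex) \<Rightarrow> real" where
  "ip_norm ip f = sqrt (Re (ip f f))"

text \<open>
  A Hilbert space of functions is given by its set of elements \<open>H\<close> and its inner product \<open>ip\<close>,
  linear in the first argument; only the values of \<open>ip\<close> on \<open>H\<close> matter.
  The kernel function at \<open>y\<close> is \<open>k\<^sub>y = k(\<cdot>, y)\<close>.
\<close>

locale rkhs =
  fixes H :: "('x \<Rightarrow> complex) set"
    and ip :: "('x \<Rightarrow> complex) \<Rightarrow> ('x \<Rightarrow> complex) \<Rightarrow> complex"
    and k :: "'x \<Rightarrow> 'x \<Rightarrow> complex"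
  assumes subspace: "fun_vs.subspace H"
    and ip_add_left: "\<lbrakk>f \<in> H; g \<in> H; h \<in> H\<rbrakk> \<Longrightarrow> ip (f + g) h = ip f h + ip g h"
    and ip_scale_left: "\<lbrakk>f \<in> H; g \<in> H\<rbrakk> \<Longrightarrow> ip (fun_scale c f) g = c * ip f g"
    and ip_commute: "\<lbrakk>f \<in> H; g \<in> H\<rbrakk> \<Longrightarrow> ip g f = cnj (ip f g)"
    and ip_nonneg: "f \<in> H \<Longrightarrow> 0 \<le> Re (ip f f)"
    and ip_definite: "\<lbrakk>f \<in> H; ip f f = 0\<rbrakk> \<Longrightarrow> f = 0"
    and complete:
      "\<lbrakk>\<And>n::nat. F n \<in> H;
        \<And>e. e > 0 \<Longrightarrow> \<exists>N. \<forall>m\<ge>N. \<forall>n\<ge>N. ip_norm ip (F m - F n) < e\<rbrakk>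
       \<Longrightarrow> \<exists>f\<in>H. (\<lambda>n. ip_norm ip (F n - f)) \<longlonglongrightarrow> 0"
    and kernel_mem: "(\<lambda>x. k x y) \<in> H"
    and reproducing: "f \<in> H \<Longrightarrow> f y = ip f (\<lambda>x. k x y)"

definition cnp_space ::
  "('x \<Rightarrow> 'i \<Rightarrow> complex) \<Rightarrow> ('x \<Rightarrow> 'x \<Rightarrow> complex) \<Rightarrow>
   ('x \<Rightarrow> complex) set \<Rightarrow> (('x \<Rightarrow> complex) \<Rightarrow> ('x \<Rightarrow> complex) \<Rightarrow> complex) \<Rightarrow> bool" where
  "cnp_space u k H ip \<longleftrightarrow> cnp_kernel u k \<and> rkhs H ip k"

definition Mult :: "('x \<Rightarrow> complex) set \<Rightarrow> ('x \<Rightarrow> complex) set" where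
  "Mult H = {\<phi>. \<forall>f\<in>H. \<phi> * f \<in> H}"

text \<open>An operator is a domain \<open>D\<close> together with a map \<open>T\<close>, whose values off \<open>D\<close> are irrelevant.\<close>

definition densely_defined_operator ::
  "('x \<Rightarrow> complex) set \<Rightarrow> (('x \<Rightarrow> complex) \<Rightarrow> ('x \<Rightarrow> complex) \<Rightarrow> complex) \<Rightarrow>
   ('x \<Rightarrow> complex) set \<Rightarrow> (('x \<Rightarrow> complex) \<Rightarrow> 'x \<Rightarrow> complex) \<Rightarrow> bool" where
  "densely_defined_operator H ip D T \<longleftrightarrow>
     D \<subseteq> H \<and> fun_vs.subspace D \<and>
     (\<forall>f\<in>H. \<forall>e>0. \<exists>g\<in>D. ip_norm ip (f - g) < e) \<and>
     (\<forall>f\<in>D. T f \<in> H) \<and>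
     (\<forall>f\<in>D. \<forall>g\<in>D. T (f + g) = T f + T g) \<and>
     (\<forall>c. \<forall>f\<in>D. T (fun_scale c f) = fun_scale c (T f))"

definition affiliated_to_Mult ::
  "('x \<Rightarrow> complex) set \<Rightarrow> ('x \<Rightarrow> complex) set \<Rightarrow> (('x \<Rightarrow> complex) \<Rightarrow> 'x \<Rightarrow> complex) \<Rightarrow> bool" where
  "affiliated_to_Mult H D T \<longleftrightarrow>
     (\<forall>f\<in>D. \<forall>\<phi>\<in>Mult H. \<phi> * f \<in> D \<and> T (\<phi> * f) = \<phi> * T f)"

end

theory Submission
  imports Defs
begin

text \<open>
  The main point is that every \<open>f \<in> H\<close> is a quotient of multipliers with a denominator that vanishes
  nowhere. If \<open>\<parallel>f\<parallel> = 1\<close>, put \<open>g x = \<langle>f, k\<^sub>x f\<rangle>\<close>; then \<open>f / g\<close> and \<open>1 - 1 / g\<close> are contractive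
  multipliers, because \<open>g x + cnj (g y) - 1 = \<langle>k\<^sub>y f, k\<^sub>x f\<rangle> - \<langle>m\<^sub>y k\<^sub>y f, m\<^sub>x k\<^sub>x f\<rangle>\<close> with
  \<open>m\<^sub>y = \<langle>u(\<cdot>), u y\<rangle> = 1 - 1 / k\<^sub>y\<close>, and the coordinates of \<open>u\<close> form a row contraction on \<open>H\<close>.
  Writing \<open>\<psi> f = \<phi>\<close> and \<open>\<psi>' f' = \<phi>'\<close> with \<open>f, f'\<close> in the domain, affiliation applied to
  \<open>\<phi>' \<psi> f = \<phi> \<psi>' f'\<close> gives \<open>f' T f = f T f'\<close>, so \<open>T\<close> is multiplication by a function.
\<close>

section \<open>Positive semidefinite kernels\<close>

lemma sum_fun_apply: "(\<Sum>x\<in>S. F x) z = (\<Sum>x\<in>S. F x z)" for F :: "'a \<Rightarrow> 'b \<Rightarrow> 'c::comm_monoid_add"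
  by (induction S rule: infinite_finite_induct) auto

text \<open>Testing only the real part amounts to positivity of the Hermitian part of
  \<open>K\<close> on every finite set, so no separate symmetry condition has to be carried
  along.\<close>

definition psd :: "('x \<Rightarrow> 'x \<Rightarrow> complex) \<Rightarrow> bool" where
  "psd K \<longleftrightarrow> (\<forall>S c. finite S \<longrightarrow> 0 \<le> Re (\<Sum>x\<in>S. \<Sum>y\<in>S. cnj (c x) * c y * K x y))"

lemma psdI:
  assumes "\<And>S c. finite S \<Longrightarrow> 0 \<le> Re (\<Sum>x\<in>S. \<Sum>y\<in>S. cnj (c x) * c y * K x y)"
  shows "psd K"
  using assms by (simp add: psd_def)

lemma psdD: "psd K \<Longrightarrow> finite S \<Longrightarrow> 0 \<le> Re (\<Sum>x\<in>S. \<Sum>y\<in>S. cnj (c x) * c y * K x y)"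
  by (simp add: psd_def)

lemma psd_add:
  assumes "psd K" "psd L"
  shows "psd (\<lambda>x y. K x y + L x y)"
  using assms by (auto simp: psd_def algebra_simps sum.distrib)

text \<open>This is a congruence by a diagonal matrix: the factors are absorbed into the
  coefficients.\<close>

lemma psd_conjugate:
  fixes K :: "'x \<Rightarrow> 'x \<Rightarrow> complex"
  assumes "psd K"
  shows "psd (\<lambda>x y. a x * cnj (a y) * K x y)"
proof (rule psdI)
  fix S :: "'x set" and c assume "finite S"
  from psdD[OF assms this, of "\<lambda>x. c x * cnj (a x)"]
  show "0 \<le> Re (\<Sum>x\<in>S. \<Sum>y\<in>S. cnj (c x) * c y * (a x * cnj (a y) * K x y))"
    by (simp add: mult_ac)
qed

lemma psd_diag: "psd K \<Longrightarrow> 0 \<le> Re (K x x)"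
  using psdD[of K "{x}" "\<lambda>_. 1"] by simp

lemma has_sum_sum_finite:
  fixes f :: "'a \<Rightarrow> 'b \<Rightarrow> 'c::topological_comm_monoid_add"
  assumes "finite S" "\<And>x. x \<in> S \<Longrightarrow> (f x has_sum s x) I"
  shows "((\<lambda>i. \<Sum>x\<in>S. f x i) has_sum (\<Sum>x\<in>S. s x)) I"
  using assms by (induction S) (auto intro!: has_sum_add)

text \<open>Each defining inequality involves a finite sum, which commutes with the summation over
  \<open>i\<close>.\<close>

lemma psd_has_sum:
  fixes K :: "'i \<Rightarrow> 'x \<Rightarrow> 'x \<Rightarrow> complex"
  assumes "\<And>i. i \<in> I \<Longrightarrow> psd (K i)"
    and "\<And>x y. ((\<lambda>i. K i x y) has_sum L x y) I"
  shows "psd L"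
proof (rule psdI)
  fix S :: "'x set" and c assume S: "finite S"
  have "((\<lambda>i. Re (\<Sum>x\<in>S. \<Sum>y\<in>S. cnj (c x) * c y * K i x y)) has_sum
      Re (\<Sum>x\<in>S. \<Sum>y\<in>S. cnj (c x) * c y * L x y)) I"
    by (intro has_sum_Re has_sum_sum_finite has_sum_cmult_right assms S)
  then show "0 \<le> Re (\<Sum>x\<in>S. \<Sum>y\<in>S. cnj (c x) * c y * L x y)"
  proof (rule has_sum_nonneg)
    fix i assume "i \<in> I"
    then have "psd (K i)" by (rule assms(1))
    then show "0 \<le> Re (\<Sum>x\<in>S. \<Sum>y\<in>S. cnj (c x) * c y * K i x y)"
      using S unfolding psd_def by blast
  qed
qed

text \<open>Expand \<open>1 / (1 - m x y)\<close> as a geometric series. The assumption on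
  \<open>m\<close> ranges over all kernels so that it can be iterated, which makes every term
  \<open>m x y ^ n * K x y\<close> positive.\<close>

lemma psd_schur_geometric:
  fixes K :: "'x \<Rightarrow> 'x \<Rightarrow> complex"
  assumes K: "psd K" and m: "\<And>K'. psd K' \<Longrightarrow> psd (\<lambda>x y. m x y * K' x y)"
    and less: "\<And>x y. cmod (m x y) < 1"
  shows "psd (\<lambda>x y. 1 / (1 - m x y) * K x y)"
proof (rule psdI)
  fix S :: "'x set" and c assume S: "finite S"
  have P: "psd (\<lambda>x y. m x y ^ n * K x y)" for n
  proof (induction n)
    case (Suc n)
    from m[OF Suc] show ?case by (simp add: mult_ac)
  qed (use K in simp)
  have sums: "(\<lambda>n. Re (\<Sum>x\<in>S. \<Sum>y\<in>S. cnj (c x) * c y * (m x y ^ n * K x y))) sums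
      Re (\<Sum>x\<in>S. \<Sum>y\<in>S. cnj (c x) * c y * (1 / (1 - m x y) * K x y))"
    by (intro sums_Re sums_sum sums_mult sums_mult2 geometric_sums less)
  have nonneg: "0 \<le> Re (\<Sum>x\<in>S. \<Sum>y\<in>S. cnj (c x) * c y * (m x y ^ n * K x y))" for n
    by (rule psdD[OF P S])
  show "0 \<le> Re (\<Sum>x\<in>S. \<Sum>y\<in>S. cnj (c x) * c y * (1 / (1 - m x y) * K x y))"
    by (rule sums_le[OF nonneg sums_zero sums])
qed

section \<open>The inner product of \<open>ell2\<close>\<close>

lemma ell2_inner_has_sum:
  assumes "v \<in> ell2" "w \<in> ell2"
  shows "((\<lambda>i. v i * cnj (w i)) has_sum ell2_inner v w) UNIV"
proof -
  have "(\<lambda>i. (cmod (v i))\<^sup>2 + (cmod (w i))\<^sup>2) summable_on UNIV"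
    using assms by (auto simp: ell2_def intro: summable_on_add)
  then have "(\<lambda>i. norm (v i * cnj (w i))) summable_on UNIV"
  proof (rule summable_on_comparison_test)
    fix i
    have "2 * cmod (v i) * cmod (w i) \<le> (cmod (v i))\<^sup>2 + (cmod (w i))\<^sup>2"
      by (rule sum_squares_bound)
    moreover have "0 \<le> cmod (v i) * cmod (w i)" by simp
    ultimately show "norm (v i * cnj (w i)) \<le> (cmod (v i))\<^sup>2 + (cmod (w i))\<^sup>2"
      unfolding norm_mult complex_mod_cnj by linarith
  qed simp
  then show ?thesis
    unfolding ell2_inner_def by (intro has_sum_infsum) (rule abs_summable_summable)
qed

lemma ell2_inner_self:
  assumes "v \<in> ell2" shows "ell2_inner v v = of_real ((ell2_norm v)\<^sup>2)"
proof -
  have "(\<lambda>i. (cmod (v i))\<^sup>2) summable_on UNIV" using assms by (simp add: ell2_def)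
  then have "((\<lambda>i. complex_of_real ((cmod (v i))\<^sup>2)) has_sum of_real (\<Sum>\<^sub>\<infinity>i. (cmod (v i))\<^sup>2)) UNIV"
    by (intro has_sum_of_real has_sum_infsum)
  moreover have "(\<lambda>i. complex_of_real ((cmod (v i))\<^sup>2)) = (\<lambda>i. v i * cnj (v i))"
    by (simp add: complex_norm_square del: of_real_power)
  moreover have "(ell2_norm v)\<^sup>2 = (\<Sum>\<^sub>\<infinity>i. (cmod (v i))\<^sup>2)"
    by (simp add: ell2_norm_def infsum_nonneg)
  ultimately show ?thesis using ell2_inner_has_sum[OF assms assms] has_sum_unique by metis
qed

text \<open>The inner product is a sum of rank one kernels, one for each coordinate, and
  multiplication by a rank one kernel is a diagonal congruence.\<close>

lemma psd_ell2_inner_mult: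
  assumes "\<And>x. u x \<in> ell2" "psd K"
  shows "psd (\<lambda>x y. ell2_inner (u x) (u y) * K x y)"
proof (rule psd_has_sum)
  show "psd (\<lambda>x y. u x i * cnj (u y i) * K x y)" for i
    using psd_conjugate[OF assms(2)] .
  show "((\<lambda>i. u x i * cnj (u y i) * K x y) has_sum ell2_inner (u x) (u y) * K x y) UNIV" for x y
    by (intro has_sum_cmult_left ell2_inner_has_sum assms)
qed

text \<open>The termwise arithmetic-geometric mean inequality bounds the inner product by the
  average of the two squared norms.\<close>

lemma ell2_inner_cmod_less:
  assumes "v \<in> ell2" "w \<in> ell2" "ell2_norm v < 1" "ell2_norm w < 1"
  shows "cmod (ell2_inner v w) < 1"
proof -
  have pos: "0 \<le> ell2_norm x" if "x\<in>ell2" for x::"'a \<Rightarrow> complex" 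
    by (simp add: ell2_norm_def infsum_nonneg)
  have s: "((\<lambda>i. (cmod (x i))\<^sup>2) has_sum (ell2_norm x)\<^sup>2) UNIV" if "x\<in>ell2" for x::"'a \<Rightarrow> complex"
    using that by (simp add: ell2_norm_def infsum_nonneg ell2_def)
  have "((\<lambda>i. ((cmod (v i))\<^sup>2 + (cmod (w i))\<^sup>2) / 2) has_sum ((ell2_norm v)\<^sup>2 + (ell2_norm w)\<^sup>2) / 2) UNIV"
    by (intro has_sum_divide_const has_sum_add s assms)
  moreover have "norm (v i * cnj (w i)) \<le> ((cmod (v i))\<^sup>2 + (cmod (w i))\<^sup>2) / 2" for i
    using sum_squares_bound[of "cmod (v i)" "cmod (w i)"] by (simp add: norm_mult)
  ultimately have "cmod (ell2_inner v w) \<le> ((ell2_norm v)\<^sup>2 + (ell2_norm w)\<^sup>2) / 2"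
    using norm_infsum_le[OF ell2_inner_has_sum[OF assms(1,2)]] by blast
  moreover have "(ell2_norm v)\<^sup>2 < 1" "(ell2_norm w)\<^sup>2 < 1"
    using assms pos by (auto simp: power_less_one_iff abs_square_less_1)
  ultimately show ?thesis by simp
qed

section \<open>Geometry of a reproducing kernel Hilbert space\<close>

context rkhs
begin

abbreviation "ker y \<equiv> (\<lambda>x. k x y)"
abbreviation "nrm \<equiv> ip_norm ip"

text \<open>The coefficients are kept explicit because the functionals and adjoints used later are
  first written in terms of them.\<close>

definition comb :: "'x set \<Rightarrow> ('x \<Rightarrow> complex) \<Rightarrow> 'x \<Rightarrow> complex" where
  "comb S d = (\<Sum>x\<in>S. fun_scale (d x) (ker x))"

lemma mem_add: "f \<in> H \<Longrightarrow> g \<in> H \<Longrightarrow> f + g \<in> H"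
  using subspace by (rule fun_vs.subspace_add)

lemma mem_scale: "f \<in> H \<Longrightarrow> fun_scale c f \<in> H"
  using subspace by (rule fun_vs.subspace_scale)

lemma mem_diff: "f \<in> H \<Longrightarrow> g \<in> H \<Longrightarrow> f - g \<in> H"
  using subspace by (rule fun_vs.subspace_diff)

lemma mem_zero: "0 \<in> H"
  using subspace by (rule fun_vs.subspace_0)

lemma mem_sum: "(\<And>x. x \<in> S \<Longrightarrow> F x \<in> H) \<Longrightarrow> (\<Sum>x\<in>S. F x) \<in> H"
  using subspace by (rule fun_vs.subspace_sum)

lemma mem_comb: "comb S d \<in> H"
  unfolding comb_def by (intro mem_sum mem_scale kernel_mem)

lemmas mem = mem_add mem_scale mem_diff mem_zero mem_sum kernel_mem mem_comb

lemma ip_add_right: "\<lbrakk>f \<in> H; g \<in> H; h \<in> H\<rbrakk> \<Longrightarrow> ip h (f + g) = ip h f + ip h g"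
  by (subst (1 2 3) ip_commute) (simp_all add: mem ip_add_left)

lemma ip_scale_right: "\<lbrakk>f \<in> H; g \<in> H\<rbrakk> \<Longrightarrow> ip g (fun_scale c f) = cnj c * ip g f"
  by (subst (1 2) ip_commute) (simp_all add: mem ip_scale_left)

lemma ip_zero_left: "f \<in> H \<Longrightarrow> ip 0 f = 0"
  using ip_add_left[of 0 0 f] mem_zero by simp

lemma ip_zero_right: "f \<in> H \<Longrightarrow> ip f 0 = 0"
  using ip_add_right[of 0 0 f] mem_zero by simp

lemma ip_diff_left: "\<lbrakk>f \<in> H; g \<in> H; h \<in> H\<rbrakk> \<Longrightarrow> ip (f - g) h = ip f h - ip g h"
  using ip_add_left[of "f - g" g h] mem by simp

lemma ip_diff_right: "\<lbrakk>f \<in> H; g \<in> H; h \<in> H\<rbrakk> \<Longrightarrow> ip h (f - g) = ip h f - ip h g"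
  using ip_add_right[of "f - g" g h] mem by simp

lemma ip_sum_left: "(\<And>x. x \<in> S \<Longrightarrow> F x \<in> H) \<Longrightarrow> h \<in> H \<Longrightarrow> ip (\<Sum>x\<in>S. F x) h = (\<Sum>x\<in>S. ip (F x) h)"
  by (induction S rule: infinite_finite_induct) (auto simp: ip_zero_left ip_add_left mem)

lemma ip_sum_right: "(\<And>x. x \<in> S \<Longrightarrow> F x \<in> H) \<Longrightarrow> h \<in> H \<Longrightarrow> ip h (\<Sum>x\<in>S. F x) = (\<Sum>x\<in>S. ip h (F x))"
  by (induction S rule: infinite_finite_induct) (auto simp: ip_zero_right ip_add_right mem)

lemmas ip_simps = ip_add_left ip_add_right ip_scale_left ip_scale_right ip_diff_left ip_diff_right
  ip_sum_left ip_sum_right ip_zero_left ip_zero_right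

lemma ip_self: "f \<in> H \<Longrightarrow> ip f f = of_real ((nrm f)\<^sup>2)"
  using ip_nonneg[of f] ip_commute[of f f] by (simp add: ip_norm_def complex_eq_iff)

lemma Re_ip_self: "f \<in> H \<Longrightarrow> Re (ip f f) = (nrm f)\<^sup>2"
  by (simp add: ip_self)

lemma nrm_nonneg: "f \<in> H \<Longrightarrow> 0 \<le> nrm f"
  by (simp add: ip_norm_def ip_nonneg)

lemma nrm_eq_0: "f \<in> H \<Longrightarrow> nrm f = 0 \<Longrightarrow> f = 0"
  by (rule ip_definite) (simp_all add: ip_self)

lemma cauchy_schwarz:
  assumes "f \<in> H" "g \<in> H" shows "cmod (ip f g) \<le> nrm f * nrm g"
proof (cases "nrm g = 0")
  case True
  then show ?thesis using nrm_eq_0[of g] assms by (simp add: ip_zero_right)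
next
  case False
  \<comment> \<open>\<open>fun_scale c g\<close> is the orthogonal projection of \<open>f\<close>
    onto the line through \<open>g\<close>.\<close>
  define c where "c = ip f g / of_real ((nrm g)\<^sup>2)"
  have pos: "(nrm g)\<^sup>2 > 0" using False by simp
  have c1: "c * cnj (ip f g) = of_real ((cmod (ip f g))\<^sup>2 / (nrm g)\<^sup>2)"
    unfolding c_def of_real_divide complex_norm_square by simp
  have c2: "c * cnj c * of_real ((nrm g)\<^sup>2) = of_real ((cmod (ip f g))\<^sup>2 / (nrm g)\<^sup>2)"
    unfolding of_real_divide complex_norm_square using pos by (simp add: c_def power2_eq_square)
  have c3: "cnj c * ip f g = of_real ((cmod (ip f g))\<^sup>2 / (nrm g)\<^sup>2)"
    unfolding of_real_divide complex_norm_square by (simp add: c_def)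
  have "ip (f - fun_scale c g) (f - fun_scale c g)
      = ip f f - cnj c * ip f g - c * cnj (ip f g) + c * cnj c * ip g g"
    using assms by (simp add: ip_simps mem algebra_simps flip: ip_commute)
  also have "\<dots> = of_real ((nrm f)\<^sup>2 - (cmod (ip f g))\<^sup>2 / (nrm g)\<^sup>2)"
    unfolding c1 c3 ip_self[OF assms(1)] ip_self[OF assms(2)] c2 by simp
  finally have "0 \<le> (nrm f)\<^sup>2 - (cmod (ip f g))\<^sup>2 / (nrm g)\<^sup>2"
    using ip_nonneg[of "f - fun_scale c g"] assms mem by simp
  then have "(cmod (ip f g))\<^sup>2 \<le> (nrm f * nrm g)\<^sup>2"
    using pos by (simp add: field_simps)
  then show ?thesis using nrm_nonneg assms by (meson mult_nonneg_nonneg power2_le_imp_le)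
qed

text \<open>This is the square-root-free bound that the membership criterion asks for; it can also
  be summed termwise.\<close>

lemma ip_bound:
  assumes "f \<in> H" "g \<in> H" shows "2 * Re (ip f g) \<le> (nrm f)\<^sup>2 + (nrm g)\<^sup>2"
proof -
  have "2 * Re (ip f g) \<le> 2 * nrm f * nrm g"
    using cauchy_schwarz[OF assms] complex_Re_le_cmod[of "ip f g"] by simp
  also have "\<dots> \<le> (nrm f)\<^sup>2 + (nrm g)\<^sup>2" by (rule sum_squares_bound)
  finally show ?thesis .
qed

lemma ip_comb: "f \<in> H \<Longrightarrow> ip f (comb S d) = (\<Sum>x\<in>S. cnj (d x) * f x)"
  unfolding comb_def by (simp add: ip_simps mem flip: reproducing)

text \<open>The arguments are swapped to agree with
  \<open>k x y = ip (ker y) (ker x)\<close>.\<close>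

lemma psd_gram:
  fixes v :: "'a \<Rightarrow> 'x \<Rightarrow> complex"
  assumes "\<And>x. v x \<in> H" shows "psd (\<lambda>x y. ip (v y) (v x))"
proof (rule psdI)
  fix S :: "'a set" and c
  have "(\<Sum>x\<in>S. \<Sum>y\<in>S. cnj (c x) * c y * ip (v y) (v x)) =
    ip (\<Sum>y\<in>S. fun_scale (c y) (v y)) (\<Sum>x\<in>S. fun_scale (c x) (v x))"
    using assms by (simp add: ip_simps mem sum_distrib_left sum_distrib_right mult_ac)
  then show "0 \<le> Re (\<Sum>x\<in>S. \<Sum>y\<in>S. cnj (c x) * c y * ip (v y) (v x))"
    using assms by (simp add: ip_nonneg mem)
qed

lemma ker_ip: "ip (ker y) (ker x) = k x y"
  by (rule reproducing[OF kernel_mem, symmetric])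

lemma comb_self: "(\<Sum>x\<in>S. \<Sum>y\<in>S. cnj (d x) * d y * k x y) = of_real ((nrm (comb S d))\<^sup>2)"
  unfolding ip_self[OF mem_comb, symmetric]
  by (simp add: comb_def ip_simps mem sum_distrib_left sum_distrib_right mult_ac ker_ip)

text \<open>Coefficients are extended by zero to the union. The two equations share the same new
  coefficients, so a combination and its formal pairing with \<open>q\<close> add together.\<close>

lemma comb_add:
  assumes "finite S" "finite S'"
  shows "comb S d + comb S' d' =
    comb (S \<union> S') (\<lambda>x. (if x \<in> S then d x else 0) + (if x \<in> S' then d' x else 0))"
    and "(\<Sum>x\<in>S. cnj (d x) * q x) + (\<Sum>x\<in>S'. cnj (d' x) * q x) =
    (\<Sum>x\<in>S \<union> S'. cnj ((if x \<in> S then d x else 0) + (if x \<in> S' then d' x else 0)) * q x)"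
proof -
  have *: "(\<Sum>x\<in>S. cnj (d x) * q x) + (\<Sum>x\<in>S'. cnj (d' x) * q x) =
    (\<Sum>x\<in>S \<union> S'. cnj ((if x \<in> S then d x else 0) + (if x \<in> S' then d' x else 0)) * q x)" for d d' and q :: "'x \<Rightarrow> complex"
  proof -
    have "(\<Sum>x\<in>S. cnj (d x) * q x) = (\<Sum>x\<in>S \<union> S'. cnj (if x \<in> S then d x else 0) * q x)"
      "(\<Sum>x\<in>S'. cnj (d' x) * q x) = (\<Sum>x\<in>S \<union> S'. cnj (if x \<in> S' then d' x else 0) * q x)"
      using assms by (auto intro!: sum.mono_neutral_cong_left)
    then show ?thesis by (simp add: sum.distrib algebra_simps)
  qed
  show "(\<Sum>x\<in>S. cnj (d x) * q x) + (\<Sum>x\<in>S'. cnj (d' x) * q x) =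
    (\<Sum>x\<in>S \<union> S'. cnj ((if x \<in> S then d x else 0) + (if x \<in> S' then d' x else 0)) * q x)"
    by (rule *)
  show "comb S d + comb S' d' =
    comb (S \<union> S') (\<lambda>x. (if x \<in> S then d x else 0) + (if x \<in> S' then d' x else 0))"
  proof
    fix z
    \<comment> \<open>At the point \<open>z\<close> this is the pairing identity for the function
      \<open>k z\<close>, with conjugated coefficients.\<close>
    show "(comb S d + comb S' d') z =
    comb (S \<union> S') (\<lambda>x. (if x \<in> S then d x else 0) + (if x \<in> S' then d' x else 0)) z"
      using *[of "\<lambda>x. cnj (d x)" "\<lambda>x. k z x" "\<lambda>x. cnj (d' x)"]
      by (simp add: comb_def sum_fun_apply fun_scale_def if_distrib[of cnj] cong: if_cong)
  qed
qed

lemma comb_scale: "fun_scale c (comb S d) = comb S (\<lambda>x. c * d x)"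
  by (auto simp: comb_def fun_scale_def sum_fun_apply sum_distrib_left mult_ac)

section \<open>Membership and multiplier criteria by duality\<close>

lemma parallelogram:
  assumes "f \<in> H" "g \<in> H"
  shows "(nrm (f - g))\<^sup>2 = 2 * (nrm f)\<^sup>2 + 2 * (nrm g)\<^sup>2 - 4 * (nrm (fun_scale (1/2) (f + g)))\<^sup>2"
proof -
  have "complex_of_real ((nrm (f - g))\<^sup>2) = of_real (2 * (nrm f)\<^sup>2 + 2 * (nrm g)\<^sup>2 - 4 * (nrm (fun_scale (1/2) (f + g)))\<^sup>2)"
    using assms by (simp only: of_real_diff of_real_add of_real_mult mem ip_self[symmetric])
      (simp add: ip_simps mem field_simps)
  then show ?thesis using of_real_eq_iff by blast
qed

lemma eval_tendsto:
  assumes "\<And>n::nat. F n \<in> H" "f \<in> H" "(\<lambda>n. nrm (F n - f)) \<longlonglongrightarrow> 0"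
  shows "(\<lambda>n. F n x) \<longlonglongrightarrow> f x"
proof -
  have bd: "cmod (F n x - f x) \<le> nrm (F n - f) * nrm (ker x)" for n
    using cauchy_schwarz[of "F n - f" "ker x"] assms
    by (simp add: mem flip: reproducing)
  have "(\<lambda>n. nrm (F n - f) * nrm (ker x)) \<longlonglongrightarrow> 0"
    using tendsto_mult_right[OF assms(3), of "nrm (ker x)"] by simp
  then have "(\<lambda>n. F n x - f x) \<longlonglongrightarrow> 0"
    by (rule Lim_null_comparison[rotated]) (simp add: bd)
  then show ?thesis by (rule LIM_zero_cancel)
qed

text \<open>
  The function \<open>q\<close> is found as the minimiser of \<open>\<parallel>v\<parallel>\<^sup>2 - 2 Re \<langle>q, v\<rangle>\<close> over the span of the
  kernel functions, on which \<open>\<langle>q, v\<rangle>\<close> is meaningful before \<open>q \<in> H\<close> is known.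
\<close>

lemma mem_if_bounded:
  assumes bd: "\<And>S d. finite S \<Longrightarrow> 2 * Re (\<Sum>x\<in>S. cnj (d x) * q x) \<le> B + (nrm (comb S d))\<^sup>2"
  shows "q \<in> H" and "(nrm q)\<^sup>2 \<le> B"
proof -
  \<comment> \<open>\<open>G\<close> is the graph of the formal pairing with \<open>q\<close>.
    Taking a relation avoids showing that the value depends only on the combination and not on its
    coefficients.\<close>
  define G where "G = {(comb S d, \<Sum>x\<in>S. cnj (d x) * q x) | S d. finite S}"
  define J where "J = (\<lambda>(v, l). (nrm v)\<^sup>2 - 2 * Re l)"
  define m where "m = Inf (J ` G)"
  have G_add: "(v + v', l + l') \<in> G" if "(v, l) \<in> G" "(v', l') \<in> G" for v l v' l'
    using that comb_add unfolding G_def by (fastforce intro: finite_UnI)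
  have G_scale: "(fun_scale c v, cnj c * l) \<in> G" if vl: "(v, l) \<in> G" for c v l
  proof -
    from vl obtain S d where S: "finite S" "v = comb S d" "l = (\<Sum>x\<in>S. cnj (d x) * q x)"
      by (auto simp: G_def)
    have "cnj c * l = (\<Sum>x\<in>S. cnj (c * d x) * q x)"
      by (simp add: S sum_distrib_left mult_ac)
    with S show ?thesis
      unfolding G_def by (intro CollectI exI[of _ S] exI[of _ "\<lambda>x. c * d x"]) (simp add: comb_scale)
  qed
  have G_ker: "(ker x, q x) \<in> G" for x
    unfolding G_def by (rule CollectI, rule exI[of _ "{x}"], rule exI[of _ "\<lambda>_. 1"])
      (simp add: comb_def fun_scale_def)
  have G_mem: "v \<in> H" if "(v, l) \<in> G" for v l
    using that by (auto simp: G_def mem)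
  have J_ge: "- B \<le> J p" if p: "p \<in> G" for p
  proof -
    obtain S d where "finite S" "p = (comb S d, \<Sum>x\<in>S. cnj (d x) * q x)"
      using p by (auto simp: G_def)
    with bd[of S d] show ?thesis by (simp add: J_def)
  qed
  have bdd: "bdd_below (J ` G)"
    using J_ge by (intro bdd_belowI2)
  have J_m: "m \<le> J p" if "p \<in> G" for p
    unfolding m_def using that bdd by (intro cInf_lower) auto
  have "\<exists>p\<in>G. J p < m + 1 / Suc n" for n
  proof -
    have "J ` G \<noteq> {}" using G_ker by auto
    then have "\<exists>y\<in>J ` G. y < m + 1 / Suc n"
      unfolding m_def by (subst cInf_less_iff[symmetric]) (auto simp: bdd)
    then show ?thesis by auto
  qed
  then obtain p where p: "\<And>n. p n \<in> G" "\<And>n. J (p n) < m + 1 / Suc n" by metis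
  define v l where "v n = fst (p n)" and "l n = snd (p n)" for n
  have vl: "(v n, l n) \<in> G" "(nrm (v n))\<^sup>2 - 2 * Re (l n) < m + 1 / Suc n" for n
    using p[of n] by (simp_all add: v_def l_def J_def split_beta)
  have vH: "v n \<in> H" for n using G_mem vl by blast
  \<comment> \<open>Midpoints stay in \<open>G\<close>, so their \<open>J\<close> is at least
    \<open>m\<close>; the parallelogram law turns this into a Cauchy estimate for the minimising
    sequence.\<close>
  have near: "(nrm (v i - v j))\<^sup>2 \<le> 2 / Suc i + 2 / Suc j" for i j
  proof -
    have "m \<le> J (fun_scale (1/2) (v i + v j), cnj (1/2) * (l i + l j))"
      by (intro J_m G_scale G_add vl)
    then have "m \<le> (nrm (fun_scale (1/2) (v i + v j)))\<^sup>2 - (Re (l i) + Re (l j))"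
      by (simp add: J_def add_divide_distrib)
    moreover have "2 / real (Suc n) = 2 * (1 / Suc n)" for n by simp
    ultimately show ?thesis
      using vl(2)[of i] vl(2)[of j] parallelogram[OF vH[of i] vH[of j]] by linarith
  qed
  have "\<exists>f\<in>H. (\<lambda>n. nrm (v n - f)) \<longlonglongrightarrow> 0"
  proof (rule complete[OF vH])
    fix e :: real assume e: "e > 0"
    obtain N where N: "inverse (Suc N) < e\<^sup>2 / 4"
      using reals_Archimedean[of "e\<^sup>2 / 4"] e by auto
    have "nrm (v i - v j) < e" if "N \<le> i" "N \<le> j" for i j
    proof -
      have "inverse (real (Suc i)) \<le> inverse (Suc N)" "inverse (real (Suc j)) \<le> inverse (Suc N)"
        using that by (auto intro!: le_imp_inverse_le)
      with near[of i j, unfolded divide_inverse] N have "(nrm (v i - v j))\<^sup>2 < e\<^sup>2"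
        by linarith
      then show ?thesis by (rule power_less_imp_less_base) (use e in simp)
    qed
    then show "\<exists>N. \<forall>i\<ge>N. \<forall>j\<ge>N. nrm (v i - v j) < e" by blast
  qed
  then obtain f where f: "f \<in> H" and lim: "(\<lambda>n. nrm (v n - f)) \<longlonglongrightarrow> 0" by blast
  have inv: "(\<lambda>n. 1 / real (Suc n)) \<longlonglongrightarrow> 0"
    using LIMSEQ_inverse_real_of_nat by (simp add: divide_inverse)
  have "f x = q x" for x
  proof (rule ccontr)
    assume ne: "f x \<noteq> q x"
    define K where "K = (nrm (ker x))\<^sup>2"
    define \<delta> where "\<delta> = f x - q x"
    have K: "K \<ge> 0" by (simp add: K_def)
    \<comment> \<open>First variation in the direction \<open>ker x\<close>: the perturbed pair lies
      in \<open>G\<close>, so its \<open>J\<close> is at least \<open>m\<close>, while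
      \<open>J\<close> at the \<open>n\<close>-th pair exceeds \<open>m\<close> by less than
      \<open>1 / Suc n\<close>.\<close>
    have *: "0 \<le> 2 * Re (cnj t * \<delta>) + (cmod t)\<^sup>2 * K" for t
    proof -
      have "- (1 / Suc n) \<le> 2 * Re (cnj t * (v n x - q x)) + (cmod t)\<^sup>2 * K" for n
      proof -
        have "(nrm (v n + fun_scale t (ker x)))\<^sup>2 = (nrm (v n))\<^sup>2 + 2 * Re (cnj t * v n x) + (cmod t)\<^sup>2 * K"
        proof -
          have "ip (ker x) (v n) = cnj (v n x)"
            using ip_commute[OF vH[of n] kernel_mem] by (simp add: vH flip: reproducing)
          moreover have "ip (v n) (ker x) = v n x" by (simp add: vH flip: reproducing)
          moreover have "Re (t * (cnj t * complex_of_real K)) = (cmod t)\<^sup>2 * K"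
            by (simp flip: mult.assoc complex_norm_square)
          ultimately show ?thesis
            by (simp add: Re_ip_self[symmetric] ip_simps mem vH)
               (simp add: K_def ip_self mem algebra_simps)
        qed
        moreover have "m \<le> J (v n + fun_scale t (ker x), l n + cnj t * q x)"
          by (intro J_m G_scale G_add vl G_ker)
        ultimately show ?thesis using vl(2)[of n] by (simp add: J_def algebra_simps)
      qed
      moreover have "(\<lambda>n. 2 * Re (cnj t * (v n x - q x)) + (cmod t)\<^sup>2 * K) \<longlonglongrightarrow>
          2 * Re (cnj t * \<delta>) + (cmod t)\<^sup>2 * K"
        unfolding \<delta>_def using eval_tendsto[OF vH f lim, of x] by (intro tendsto_intros)
      moreover have "(\<lambda>n. - (1 / real (Suc n))) \<longlonglongrightarrow> 0"
        using tendsto_minus[OF inv] by simp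
      ultimately show ?thesis
        by (intro LIMSEQ_le[of "\<lambda>n. - (1 / real (Suc n))"]) auto
    qed
    \<comment> \<open>With \<open>t\<close> equal to \<open>- s * \<delta>\<close> the linear term
      dominates the quadratic one as soon as \<open>s * K < 2\<close>, which contradicts the
      variation inequality. Adding 1 keeps the denominator positive.\<close>
    define s where "s = 1 / (K + 1)"
    have s: "s > 0" "s * K < 1" using K by (auto simp: s_def field_simps)
    have "Re (cnj \<delta> * \<delta>) = (cmod \<delta>)\<^sup>2" unfolding cmod_power2 by (simp add: power2_eq_square)
    then have "0 \<le> - 2 * s * (cmod \<delta>)\<^sup>2 + s\<^sup>2 * (cmod \<delta>)\<^sup>2 * K"
      using *[of "- of_real s * \<delta>"] by (simp add: norm_mult power_mult_distrib mult.assoc)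
    then have "0 \<le> (s * (cmod \<delta>)\<^sup>2) * (s * K - 2)" by (simp add: algebra_simps power2_eq_square)
    moreover have "s * (cmod \<delta>)\<^sup>2 > 0" using s ne by (simp add: \<delta>_def)
    ultimately show False using s by (simp add: zero_le_mult_iff)
  qed
  then have fq: "f = q" by blast
  with f show "q \<in> H" by simp
  \<comment> \<open>Since \<open>l n\<close> is now a true inner product with \<open>f\<close>,
    completing the square gives \<open>J\<close> at the \<open>n\<close>-th pair as
    \<open>(nrm (v n - f))\<^sup>2 - (nrm f)\<^sup>2\<close>, which is at least
    \<open>- B\<close>.\<close>
  have "- B + (nrm f)\<^sup>2 \<le> (nrm (v n - f))\<^sup>2" for n
  proof -
    obtain S d where S: "v n = comb S d" "l n = (\<Sum>x\<in>S. cnj (d x) * q x)"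
      using vl(1)[of n] by (auto simp: G_def)
    have l: "l n = ip f (v n)" using ip_comb[OF f, of S d] S fq by simp
    have "(nrm (v n - f))\<^sup>2 = (nrm (v n))\<^sup>2 - 2 * Re (ip f (v n)) + (nrm f)\<^sup>2"
      using ip_commute[OF f vH[of n]]
      by (simp add: Re_ip_self[symmetric] ip_simps mem vH f)
    with J_ge[OF vl(1), of n] l show ?thesis by (simp add: J_def)
  qed
  moreover have "(\<lambda>n. (nrm (v n - f))\<^sup>2) \<longlonglongrightarrow> 0\<^sup>2"
    by (intro tendsto_power lim)
  ultimately have "- B + (nrm f)\<^sup>2 \<le> 0\<^sup>2" using LIMSEQ_le_const by blast
  then show "(nrm q)\<^sup>2 \<le> B" by (simp add: fq)
qed

text \<open>Positivity says that the prospective adjoint, sending \<open>ker x\<close> to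
  \<open>cnj (\<phi> x)\<close> times \<open>ker x\<close>, is contractive on kernel combinations.
  Pairing with \<open>h\<close> then verifies the membership criterion for
  \<open>\<phi> * h\<close>.\<close>

lemma Mult_if_psd:
  assumes psd: "psd (\<lambda>x y. k x y * (1 - \<phi> x * cnj (\<phi> y)))"
  shows "\<phi> \<in> Mult H"
  unfolding Mult_def
proof (intro CollectI ballI)
  fix h assume h: "h \<in> H"
  show "\<phi> * h \<in> H"
  proof (rule mem_if_bounded)
    fix S d assume S: "finite (S :: 'x set)"
    \<comment> \<open>\<open>w\<close> is the prospective adjoint applied to
      \<open>comb S d\<close>.\<close>
    define w where "w = comb S (\<lambda>x. d x * cnj (\<phi> x))"
    have "(\<Sum>x\<in>S. \<Sum>y\<in>S. cnj (d x) * d y * (k x y * (1 - \<phi> x * cnj (\<phi> y)))) =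
      of_real ((nrm (comb S d))\<^sup>2 - (nrm w)\<^sup>2)"
      unfolding of_real_diff w_def comb_self[symmetric] by (simp add: sum_subtractf algebra_simps)
    with psdD[OF psd S, of d] have "(nrm w)\<^sup>2 \<le> (nrm (comb S d))\<^sup>2" by simp
    moreover have "(\<Sum>x\<in>S. cnj (d x) * (\<phi> * h) x) = ip h w"
      unfolding w_def ip_comb[OF h] by (simp add: mult_ac)
    moreover have "2 * Re (ip h w) \<le> (nrm h)\<^sup>2 + (nrm w)\<^sup>2"
      by (rule ip_bound) (simp_all add: h w_def mem)
    ultimately show "2 * Re (\<Sum>x\<in>S. cnj (d x) * (\<phi> * h) x) \<le> (nrm h)\<^sup>2 + (nrm (comb S d))\<^sup>2"
      by simp
  qed
qed

lemma Mult_diff: "a \<in> Mult H \<Longrightarrow> b \<in> Mult H \<Longrightarrow> a - b \<in> Mult H"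
  by (simp add: Mult_def left_diff_distrib mem)

lemma Mult_mult: "a \<in> Mult H \<Longrightarrow> b \<in> Mult H \<Longrightarrow> a * b \<in> Mult H"
  by (simp add: Mult_def mult.assoc)

lemma Mult_one: "1 \<in> Mult H"
  by (simp add: Mult_def)

lemma Mult_zero: "0 \<in> Mult H"
  by (simp add: Mult_def mem)

end

section \<open>CNP kernels and the row of coordinate multipliers\<close>

locale cnp_rkhs = rkhs H ip k
  for H :: "('x \<Rightarrow> complex) set"
    and ip :: "('x \<Rightarrow> complex) \<Rightarrow> ('x \<Rightarrow> complex) \<Rightarrow> complex"
    and k :: "'x \<Rightarrow> 'x \<Rightarrow> complex" +
  fixes u :: "'x \<Rightarrow> 'i \<Rightarrow> complex"
  assumes cnp: "cnp_kernel u k"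
begin

definition "m x y = ell2_inner (u x) (u y)"

lemma u_ell2: "u x \<in> ell2" and u_less: "ell2_norm (u x) < 1"
  using cnp by (auto simp: cnp_kernel_def)

lemma m_less: "cmod (m x y) < 1"
  unfolding m_def by (intro ell2_inner_cmod_less u_ell2 u_less)

lemma m_neq_1: "m x y \<noteq> 1"
  using m_less[of x y] by auto

lemma k_eq: "k x y = 1 / (1 - m x y)"
  using cnp by (simp add: cnp_kernel_def m_def)

lemma k_neq_0: "k x y \<noteq> 0"
  using m_neq_1[of x y] by (simp add: k_eq)

lemma m_k: "m x y * k x y = k x y - 1"
  using m_neq_1[of x y] by (simp add: k_eq field_simps)

lemma m_self: "m x x = of_real ((ell2_norm (u x))\<^sup>2)"
  by (simp add: m_def ell2_inner_self u_ell2)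

lemma psd_m_mult: "psd K \<Longrightarrow> psd (\<lambda>x y. m x y * K x y)"
  unfolding m_def by (intro psd_ell2_inner_mult u_ell2)

text \<open>The kernel is the geometric series in \<open>m\<close>, and each factor \<open>m\<close>
  preserves positivity.\<close>

lemma psd_k_mult: "psd K \<Longrightarrow> psd (\<lambda>x y. k x y * K x y)"
  unfolding k_eq by (intro psd_schur_geometric psd_m_mult m_less)

lemma m_has_sum: "((\<lambda>i. u x i * cnj (u y i)) has_sum m x y) UNIV"
  unfolding m_def by (intro ell2_inner_has_sum u_ell2)

text \<open>
  The coordinate functions form a row contraction: by duality with kernel combinations this
  reduces to \<open>\<langle>u x, u y\<rangle> k x y = k x y - 1\<close>.
\<close>

lemma row_contraction:
  fixes S :: "'x set"
  assumes S: "finite S" and h: "\<And>y. y \<in> S \<Longrightarrow> h y \<in> H"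
  defines "q \<equiv> (\<lambda>x. \<Sum>y\<in>S. m x y * h y x)"
  shows "q \<in> H" and "(nrm q)\<^sup>2 \<le> Re (\<Sum>x\<in>S. \<Sum>y\<in>S. m x y * ip (h y) (h x))"
proof -
  define B where "B = Re (\<Sum>x\<in>S. \<Sum>y\<in>S. m x y * ip (h y) (h x))"
  \<comment> \<open>The \<open>P i\<close> form the column to which the row of coordinates is
    applied: \<open>q x\<close> is the sum over \<open>i\<close> of
    \<open>u x i * P i x\<close>.\<close>
  define P where "P i = (\<Sum>y\<in>S. fun_scale (cnj (u y i)) (h y))" for i
  have P: "P i \<in> H" for i unfolding P_def using h by (intro mem)
  have B: "((\<lambda>i. (nrm (P i))\<^sup>2) has_sum B) UNIV"
  proof -
    have "((\<lambda>i. Re (\<Sum>x\<in>S. \<Sum>y\<in>S. u x i * cnj (u y i) * ip (h y) (h x))) has_sum B) UNIV"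
      unfolding B_def by (intro has_sum_Re has_sum_sum_finite has_sum_cmult_left m_has_sum S)
    moreover have "(nrm (P i))\<^sup>2 = Re (\<Sum>x\<in>S. \<Sum>y\<in>S. u x i * cnj (u y i) * ip (h y) (h x))" for i
    proof -
      have "ip (P i) (P i) = (\<Sum>x\<in>S. \<Sum>y\<in>S. u x i * cnj (u y i) * ip (h y) (h x))"
        unfolding P_def using h
        by (simp add: ip_simps mem sum_distrib_left sum_distrib_right mult_ac)
      then show ?thesis by (simp flip: Re_ip_self[OF P])
    qed
    ultimately show ?thesis by simp
  qed
  have "2 * Re (\<Sum>x\<in>S'. cnj (d x) * q x) \<le> B + (nrm (comb S' d))\<^sup>2"
    if S': "finite S'" for S' :: "'x set" and d
  proof -
    \<comment> \<open>\<open>Q i\<close> is the prospective adjoint of the \<open>i\<close>-th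
      coordinate multiplication, applied to \<open>comb S' d\<close>.\<close>
    define Q where "Q i = comb S' (\<lambda>x. d x * cnj (u x i))" for i
    have Q: "Q i \<in> H" for i unfolding Q_def by (rule mem)
    have "((\<lambda>i. \<Sum>x\<in>S'. cnj (d x) * (\<Sum>y\<in>S. u x i * cnj (u y i) * h y x)) has_sum
        (\<Sum>x\<in>S'. cnj (d x) * q x)) UNIV"
      unfolding q_def
      by (intro has_sum_sum_finite has_sum_cmult_right has_sum_cmult_left m_has_sum S S')
    moreover have "(\<Sum>x\<in>S'. cnj (d x) * (\<Sum>y\<in>S. u x i * cnj (u y i) * h y x)) = ip (P i) (Q i)" for i
      unfolding Q_def ip_comb[OF P]
      by (simp add: P_def sum_fun_apply fun_scale_def sum_distrib_left mult_ac)
    ultimately have PQ: "((\<lambda>i. 2 * Re (ip (P i) (Q i))) has_sum 2 * Re (\<Sum>x\<in>S'. cnj (d x) * q x)) UNIV"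
      by (intro has_sum_cmult_right has_sum_Re) simp
    have "((\<lambda>i. Re (\<Sum>x\<in>S'. \<Sum>y\<in>S'. cnj (d x) * d y * (u x i * cnj (u y i) * k x y))) has_sum
        Re (\<Sum>x\<in>S'. \<Sum>y\<in>S'. cnj (d x) * d y * (m x y * k x y))) UNIV"
      by (intro has_sum_Re has_sum_sum_finite has_sum_cmult_right has_sum_cmult_left m_has_sum S')
    moreover have "(nrm (Q i))\<^sup>2 = Re (\<Sum>x\<in>S'. \<Sum>y\<in>S'. cnj (d x) * d y * (u x i * cnj (u y i) * k x y))" for i
    proof -
      have "complex_of_real ((nrm (Q i))\<^sup>2) = (\<Sum>x\<in>S'. \<Sum>y\<in>S'. cnj (d x) * d y * (u x i * cnj (u y i) * k x y))"
        unfolding Q_def comb_self[symmetric] by (simp add: mult_ac)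
      then show ?thesis by (metis Re_complex_of_real)
    qed
    \<comment> \<open>By \<open>m_k\<close> the left side is
      \<open>(nrm (comb S' d))\<^sup>2\<close> minus the squared modulus of the sum of the
      \<open>d x\<close>.\<close>
    moreover have "Re (\<Sum>x\<in>S'. \<Sum>y\<in>S'. cnj (d x) * d y * (m x y * k x y)) \<le> (nrm (comb S' d))\<^sup>2"
    proof -
      have "(\<Sum>x\<in>S'. \<Sum>y\<in>S'. cnj (d x) * d y * (m x y * k x y)) =
          (\<Sum>x\<in>S'. \<Sum>y\<in>S'. cnj (d x) * d y * k x y - cnj (d x) * d y)"
        by (intro sum.cong refl) (simp only: m_k right_diff_distrib mult_1_right)
      also have "\<dots> = of_real ((nrm (comb S' d))\<^sup>2) - cnj (\<Sum>x\<in>S'. d x) * (\<Sum>x\<in>S'. d x)"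
        unfolding comb_self[symmetric] by (simp add: sum_subtractf sum_product)
      also have "\<dots> = of_real ((nrm (comb S' d))\<^sup>2 - (cmod (\<Sum>x\<in>S'. d x))\<^sup>2)"
        unfolding of_real_diff complex_norm_square by (simp only: mult.commute)
      finally show ?thesis by (simp only: Re_complex_of_real) simp
    qed
    ultimately have "((\<lambda>i. (nrm (Q i))\<^sup>2) has_sum Re (\<Sum>x\<in>S'. \<Sum>y\<in>S'. cnj (d x) * d y * (m x y * k x y))) UNIV"
      "Re (\<Sum>x\<in>S'. \<Sum>y\<in>S'. cnj (d x) * d y * (m x y * k x y)) \<le> (nrm (comb S' d))\<^sup>2"
      by simp_all
    \<comment> \<open>Sum \<open>ip_bound\<close> for \<open>P i\<close> and \<open>Q i\<close> over
      \<open>i\<close>.\<close>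
    with has_sum_mono[OF PQ has_sum_add[OF B this(1)]] ip_bound[OF P Q] show ?thesis
      by force
  qed
  from mem_if_bounded[OF this] show "q \<in> H" "(nrm q)\<^sup>2 \<le> B" by auto
qed

text \<open>This is the row contraction for the single point \<open>y\<close>, where
  \<open>m y y\<close> is the squared norm of \<open>u y\<close>.\<close>

lemma m_mult_mem:
  assumes "h \<in> H"
  shows "(\<lambda>x. m x y * h x) \<in> H" and "nrm (\<lambda>x. m x y * h x) \<le> ell2_norm (u y) * nrm h"
proof -
  show mem: "(\<lambda>x. m x y * h x) \<in> H"
    using row_contraction(1)[of "{y}" "\<lambda>_. h"] assms by simp
  have "(nrm (\<lambda>x. m x y * h x))\<^sup>2 \<le> (ell2_norm (u y) * nrm h)\<^sup>2"
    using row_contraction(2)[of "{y}" "\<lambda>_. h"] assms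
    by (simp add: m_self ip_self power_mult_distrib)
  moreover have "0 \<le> ell2_norm (u y)" by (simp add: ell2_norm_def infsum_nonneg)
  ultimately show "nrm (\<lambda>x. m x y * h x) \<le> ell2_norm (u y) * nrm h"
    using nrm_nonneg[OF assms] by (meson mult_nonneg_nonneg power2_le_imp_le)
qed

text \<open>
  The adjoint of multiplication by \<open>m _ y\<close>, which has norm less than 1, acts diagonally on kernel
  functions; hence the adjoint of multiplication by \<open>1 - m _ y = 1 / ker y\<close> is bounded below.
\<close>

lemma ker_mult_mem:
  assumes h: "h \<in> H" shows "ker y * h \<in> H"
proof (rule mem_if_bounded)
  define r where "r = ell2_norm (u y)"
  have r: "r < 1" unfolding r_def by (rule u_less)
  fix S :: "'x set" and d assume S: "finite S"
  \<comment> \<open>\<open>v\<close> is the prospective adjoint of multiplication by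
    \<open>ker y\<close> at \<open>comb S d\<close>, and \<open>w\<close> is the adjoint of
    multiplication by \<open>m _ y\<close> at \<open>v\<close>. From
    \<open>nrm w \<le> r * nrm v\<close> and \<open>v - w = comb S d\<close> follows a bound on
    \<open>nrm v\<close>.\<close>
  define v where "v = comb S (\<lambda>x. d x * cnj (k x y))"
  define w where "w = comb S (\<lambda>x. d x * cnj (k x y) * cnj (m x y))"
  have vH: "v \<in> H" and wH: "w \<in> H" by (simp_all add: v_def w_def mem)
  have vw: "v - w = comb S d"
  proof
    fix z
    have "d x * cnj (k x y) * a - d x * cnj (k x y) * cnj (m x y) * a = d x * a" for x a
    proof -
      have "cnj (k x y) - cnj (m x y) * cnj (k x y) = 1"
        by (simp add: m_k flip: complex_cnj_mult)
      then have "d x * a * (cnj (k x y) - cnj (m x y) * cnj (k x y)) = d x * a" by simp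
      then show ?thesis by (simp add: right_diff_distrib mult_ac)
    qed
    then show "(v - w) z = comb S d z"
      by (simp add: v_def w_def comb_def sum_fun_apply fun_scale_def flip: sum_subtractf)
  qed
  have "(nrm w)\<^sup>2 \<le> r * nrm w * nrm v"
  proof -
    have "ip w w = (\<Sum>x\<in>S. cnj (d x * cnj (k x y) * cnj (m x y)) * w x)"
      unfolding w_def by (rule ip_comb) (rule mem)
    also have "\<dots> = ip (\<lambda>x. m x y * w x) v"
      unfolding v_def ip_comb[OF m_mult_mem(1)[OF wH]] by (simp add: mult_ac)
    finally have "(nrm w)\<^sup>2 \<le> cmod (ip (\<lambda>x. m x y * w x) v)"
      by (metis Re_ip_self complex_Re_le_cmod wH)
    also have "\<dots> \<le> nrm (\<lambda>x. m x y * w x) * nrm v"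
      by (intro cauchy_schwarz m_mult_mem wH vH)
    also have "\<dots> \<le> r * nrm w * nrm v"
      unfolding r_def by (intro mult_right_mono m_mult_mem wH nrm_nonneg vH)
    finally show ?thesis .
  qed
  then have wv: "nrm w \<le> r * nrm v"
  proof (cases "nrm w = 0")
    case True
    have "0 \<le> r" by (simp add: r_def ell2_norm_def infsum_nonneg)
    with True nrm_nonneg[OF vH] show ?thesis by simp
  next
    case False
    with nrm_nonneg[OF wH] have "0 < nrm w" by simp
    moreover assume "(nrm w)\<^sup>2 \<le> r * nrm w * nrm v"
    then have "nrm w * nrm w \<le> nrm w * (r * nrm v)" by (simp add: power2_eq_square mult_ac)
    ultimately show ?thesis using mult_le_cancel_left_pos by blast
  qed
  have "nrm v \<le> nrm w + nrm (comb S d)"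
  proof -
    have "(nrm v)\<^sup>2 = Re (ip v v)" by (simp add: Re_ip_self vH)
    also have "ip v v = ip w v + ip (comb S d) v"
      unfolding vw[symmetric] by (simp add: ip_simps vH wH)
    also have "Re \<dots> \<le> nrm w * nrm v + nrm (comb S d) * nrm v"
      using cauchy_schwarz[OF wH vH] cauchy_schwarz[OF mem_comb[of S d] vH]
        complex_Re_le_cmod[of "ip w v"] complex_Re_le_cmod[of "ip (comb S d) v"] by simp
    finally have "nrm v * nrm v \<le> (nrm w + nrm (comb S d)) * nrm v"
      by (simp add: power2_eq_square algebra_simps)
    then show ?thesis using nrm_nonneg[OF vH] nrm_nonneg[OF wH] nrm_nonneg[OF mem_comb[of S d]]
      by (cases "nrm v = 0") auto
  qed
  with wv have "(1 - r) * nrm v \<le> nrm (comb S d)" by (simp add: algebra_simps)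
  then have v: "nrm v \<le> nrm (comb S d) / (1 - r)" using r by (simp add: field_simps)
  have "(\<Sum>x\<in>S. cnj (d x) * (ker y * h) x) = ip h v"
    unfolding v_def ip_comb[OF h] by (simp add: mult_ac)
  moreover have "2 * Re (ip h v) \<le> 2 * (nrm h / (1 - r)) * nrm (comb S d)"
  proof -
    have "Re (ip h v) \<le> nrm h * nrm v"
      using cauchy_schwarz[OF h vH] complex_Re_le_cmod[of "ip h v"] by simp
    also have "\<dots> \<le> nrm h * (nrm (comb S d) / (1 - r))"
      by (intro mult_left_mono v nrm_nonneg h)
    finally show ?thesis by simp
  qed
  ultimately show "2 * Re (\<Sum>x\<in>S. cnj (d x) * (ker y * h) x) \<le> (nrm h / (1 - r))\<^sup>2 + (nrm (comb S d))\<^sup>2"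
    using sum_squares_bound[of "nrm h / (1 - r)" "nrm (comb S d)"] by simp
qed

section \<open>Functions in \<open>H\<close> as quotients of multipliers\<close>

lemma cnj_k: "cnj (k y x) = k x y"
  using ip_commute[OF kernel_mem kernel_mem, of y x] by (simp add: ker_ip)

lemma k_diag: "Re (k x x) > 0"
proof -
  have "k x x = of_real ((nrm (ker x))\<^sup>2)"
    by (simp only: ip_self[OF kernel_mem, symmetric] ker_ip)
  moreover from this have "nrm (ker x) \<noteq> 0" using k_neq_0[of x x] by auto
  ultimately show ?thesis by simp
qed

text \<open>
  Positivity of \<open>k x y * (1 - \<phi> x * cnj (\<phi> y))\<close> for \<open>\<phi> = f / g\<close> and for \<open>\<phi> = 1 - 1 / g\<close>, where
  \<open>g x = \<langle>f, ker x * f\<rangle>\<close>, comes down to positivity of this kernel times \<open>k\<close>.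
\<close>

lemma psd_mult_defect:
  assumes f: "f \<in> H"
  shows "psd (\<lambda>x y. m x y * ip (ker y * f) (ker x * f) - ip (ker y * f - f) (ker x * f - f))"
proof (rule psdI)
  fix S :: "'x set" and c assume S: "finite S"
  define h where "h y = ker y * f" for y
  have h: "h y \<in> H" for y unfolding h_def by (rule ker_mult_mem[OF f])
  define q where "q = (\<Sum>y\<in>S. fun_scale (c y) (h y - f))"
  have m_h: "m x y * h y x = h y x - f x" for x y
  proof -
    have "m x y * h y x = (m x y * k x y) * f x" by (simp add: h_def)
    then show ?thesis by (simp add: m_k h_def left_diff_distrib)
  qed
  \<comment> \<open>The row of coordinates thus produces \<open>q\<close> from the
    \<open>h y\<close>, so the row contraction compares the two Gram sums.\<close>
  have "(\<lambda>x. \<Sum>y\<in>S. m x y * fun_scale (c y) (h y) x) = q"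
    by (simp add: fun_eq_iff q_def sum_fun_apply fun_scale_def m_h mult.left_commute[of "m _ _"])
  then have "(nrm q)\<^sup>2 \<le> Re (\<Sum>x\<in>S. \<Sum>y\<in>S. m x y * ip (fun_scale (c y) (h y)) (fun_scale (c x) (h x)))"
    using row_contraction(2)[OF S, of "\<lambda>y. fun_scale (c y) (h y)"] h mem by simp
  also have "\<dots> = Re (\<Sum>x\<in>S. \<Sum>y\<in>S. cnj (c x) * c y * (m x y * ip (h y) (h x)))"
    using h by (simp add: ip_scale_left ip_scale_right mem mult_ac)
  finally have "(nrm q)\<^sup>2 \<le> Re (\<Sum>x\<in>S. \<Sum>y\<in>S. cnj (c x) * c y * (m x y * ip (h y) (h x)))" .
  moreover have "q \<in> H" unfolding q_def using h f by (intro mem)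
  moreover from this have "(nrm q)\<^sup>2 = Re (ip q q)" by (simp add: Re_ip_self)
  moreover have "ip q q = (\<Sum>x\<in>S. \<Sum>y\<in>S. cnj (c x) * c y * ip (h y - f) (h x - f))"
    unfolding q_def using h f
    by (simp add: ip_sum_left ip_sum_right ip_scale_left ip_scale_right mem
        sum_distrib_left sum_distrib_right mult_ac)
  ultimately show "0 \<le> Re (\<Sum>x\<in>S. \<Sum>y\<in>S. cnj (c x) * c y *
      (m x y * ip (ker y * f) (ker x * f) - ip (ker y * f - f) (ker x * f - f)))"
    unfolding h_def[symmetric] by (simp only: right_diff_distrib sum_subtractf minus_complex.simps)
qed

text \<open>The denominator is \<open>\<psi> = 1 / g\<close>. It is a multiplier because
  \<open>1 - \<psi>\<close> is one, and the numerator is \<open>f / g\<close>.\<close>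

lemma smirnov_quotient_unit:
  assumes f: "f \<in> H" and unit: "ip f f = 1"
  obtains \<phi> \<psi> where "\<phi> \<in> Mult H" "\<psi> \<in> Mult H" "\<And>x. \<psi> x \<noteq> 0" "\<phi> = \<psi> * f"
proof -
  define h where "h y = ker y * f" for y
  define g where "g x = ip f (h x)" for x
  have h: "h y \<in> H" for y unfolding h_def by (rule ker_mult_mem[OF f])
  have hf: "ip (h y) f = cnj (g y)" for y
    using ip_commute[OF f h] by (simp add: g_def)
  \<comment> \<open>\<open>E\<close> is \<open>k\<close> times the defect kernel, rewritten with
    \<open>m_k\<close>. Adding the Gram kernel of \<open>h\<close> leaves the kernel that governs
    \<open>\<psi>\<close>; conjugating by \<open>\<phi>\<close> serves for
    \<open>\<phi>\<close>.\<close>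
  define E where "E x y = k x y * (g x + cnj (g y) - 1) - ip (h y) (h x)" for x y
  have "psd (\<lambda>x y. k x y * (m x y * ip (h y) (h x) - ip (h y - f) (h x - f)))"
    unfolding h_def by (intro psd_k_mult psd_mult_defect f)
  moreover have "k x y * (m x y * ip (h y) (h x) - ip (h y - f) (h x - f)) = E x y" for x y
  proof -
    have eq: "ip (h y - f) (h x - f) = ip (h y) (h x) - (g x + cnj (g y) - 1)"
      using h f by (simp add: ip_diff_left ip_diff_right mem hf unit flip: g_def)
    have "k x y * (m x y * ip (h y) (h x) - ip (h y - f) (h x - f)) =
        (m x y * k x y) * ip (h y) (h x) - k x y * ip (h y) (h x) + k x y * (g x + cnj (g y) - 1)"
      unfolding eq by (simp add: algebra_simps)
    then show ?thesis unfolding m_k E_def by (simp add: left_diff_distrib)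
  qed
  ultimately have E: "psd E" by simp
  have psd_g: "psd (\<lambda>x y. k x y * (g x + cnj (g y) - 1))"
    using psd_add[OF psd_gram[of h, OF h] E] by (simp add: E_def)
  \<comment> \<open>On the diagonal, positivity forces the real part of \<open>g x\<close> to be at
    least 1/2.\<close>
  have g: "g x \<noteq> 0" for x
    using psd_diag[OF psd_g, of x] k_diag[of x] by auto
  define \<psi> where "\<psi> x = 1 / g x" for x
  have "psd (\<lambda>x y. k x y * (1 - (1 - \<psi>) x * cnj ((1 - \<psi>) y)))"
  proof -
    have "\<psi> x * cnj (\<psi> y) * (k x y * (g x + cnj (g y) - 1)) =
        k x y * (1 - (1 - \<psi>) x * cnj ((1 - \<psi>) y))" for x y
      using g[of x] g[of y] by (simp add: \<psi>_def field_simps)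
    then show ?thesis using psd_conjugate[OF psd_g, of \<psi>] by (simp only:)
  qed
  then have "1 - \<psi> \<in> Mult H" by (rule Mult_if_psd)
  from Mult_diff[OF Mult_one this] have \<psi>: "\<psi> \<in> Mult H"
    by (rule back_subst[of "\<lambda>a. a \<in> Mult H"]) (simp add: fun_eq_iff)
  define \<phi> where "\<phi> = \<psi> * f"
  have f_eq: "f x = \<phi> x * g x" for x using g by (simp add: \<phi>_def \<psi>_def)
  \<comment> \<open>In the Gram kernel of \<open>v\<close> the cross terms and the
    \<open>ip (h y) (h x)\<close> term cancel against the conjugated \<open>E\<close>, leaving the
    multiplier kernel of \<open>\<phi>\<close>.\<close>
  define v where "v x = ker x - fun_scale (cnj (\<phi> x)) (h x)" for x
  have v: "v x \<in> H" for x unfolding v_def using h by (intro mem)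
  have "ip (v y) (v x) + \<phi> x * cnj (\<phi> y) * E x y = k x y * (1 - \<phi> x * cnj (\<phi> y))" for x y
  proof -
    have hk: "ip (h y) (ker x) = k x y * (\<phi> x * g x)" for x y
      by (simp add: h f_eq flip: reproducing) (simp add: h_def f_eq)
    have kh: "ip (ker y) (h x) = k x y * cnj (\<phi> y * g y)"
      by (subst ip_commute[OF h kernel_mem]) (simp only: hk complex_cnj_mult cnj_k)
    have "ip (v y) (v x) = k x y - cnj (\<phi> y) * ip (h y) (ker x) - \<phi> x * ip (ker y) (h x)
        + cnj (\<phi> y) * \<phi> x * ip (h y) (h x)"
      unfolding v_def using h
      by (simp add: ip_diff_left ip_diff_right ip_scale_left ip_scale_right mem ker_ip algebra_simps)
    then show ?thesis unfolding hk kh E_def by (simp add: algebra_simps)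
  qed
  then have "psd (\<lambda>x y. k x y * (1 - \<phi> x * cnj (\<phi> y)))"
    using psd_add[OF psd_gram[of v, OF v] psd_conjugate[OF E, of \<phi>]] by (simp only:)
  then have "\<phi> \<in> Mult H" by (rule Mult_if_psd)
  then show thesis using that \<psi> g by (simp add: \<phi>_def \<psi>_def)
qed

lemma Mult_scale: "a \<in> Mult H \<Longrightarrow> fun_scale c a \<in> Mult H"
proof -
  have "fun_scale c a * h = fun_scale c (a * h)" for h
    by (auto simp: fun_scale_def)
  then show "a \<in> Mult H \<Longrightarrow> fun_scale c a \<in> Mult H"
    by (simp add: Mult_def mem)
qed

text \<open>Normalising \<open>f\<close> only rescales the numerator, and the zero function is
  \<open>0 / 1\<close>.\<close>

lemma smirnov_quotient:
  assumes f: "f \<in> H"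
  obtains \<phi> \<psi> where "\<phi> \<in> Mult H" "\<psi> \<in> Mult H" "\<And>x. \<psi> x \<noteq> 0" "\<phi> = \<psi> * f"
proof (cases "f = 0")
  case True
  then show thesis using that[of 0 1] by (simp add: Mult_zero Mult_one)
next
  case False
  then have nz: "nrm f \<noteq> 0" using nrm_eq_0 f by blast
  define c where "c = complex_of_real (1 / nrm f)"
  have "ip (fun_scale c f) (fun_scale c f) = 1"
    using f nz by (simp add: ip_scale_left ip_scale_right mem)
      (simp add: ip_self c_def power2_eq_square)
  then obtain \<phi> \<psi> where *: "\<phi> \<in> Mult H" "\<psi> \<in> Mult H" "\<And>x. \<psi> x \<noteq> 0" "\<phi> = \<psi> * fun_scale c f"
    using smirnov_quotient_unit[OF mem_scale[OF f]] by blast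
  have "fun_scale (1 / c) \<phi> = \<psi> * f"
    using nz by (simp add: *(4) fun_eq_iff fun_scale_def c_def)
  with * Mult_scale[OF *(1), of "1 / c"] show thesis using that by blast
qed

end

text \<open>Nonvanishing of \<open>b\<close> is tied to \<open>T\<close> being nonzero on
  \<open>D\<close>: if \<open>T\<close> vanishes there, density forces \<open>h = 0\<close>, because
  every point has some \<open>f\<close> in \<open>D\<close> not vanishing at it, and then
  \<open>b = a * h\<close> is zero.\<close>

theorem theorem2p4:
  fixes u :: "'x \<Rightarrow> 'i \<Rightarrow> complex"
    and k :: "'x \<Rightarrow> 'x \<Rightarrow> complex"
    and H D :: "('x \<Rightarrow> complex) set"
    and ip :: "('x \<Rightarrow> complex) \<Rightarrow> ('x \<Rightarrow> complex) \<Rightarrow> complex"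
    and T :: "('x \<Rightarrow> complex) \<Rightarrow> 'x \<Rightarrow> complex"
  assumes "cnp_space u k H ip"
    and "densely_defined_operator H ip D T"
    and "affiliated_to_Mult H D T"
  shows "\<exists>h :: 'x \<Rightarrow> complex.
           (\<forall>f\<in>D. \<forall>x. T f x = h x * f x) \<and>
           (\<exists>a\<in>Mult H. \<exists>b\<in>Mult H.
              a \<noteq> 0 \<and> ((\<exists>f\<in>D. T f \<noteq> 0) \<longrightarrow> b \<noteq> 0) \<and> (\<forall>x. b x = a x * h x))"
proof -
  interpret rkhs H ip k
    using assms(1) by (simp add: cnp_space_def)
  interpret cnp_rkhs H ip k u
    using assms(1) by unfold_locales (simp add: cnp_space_def)
  have DH: "f \<in> H" and TH: "T f \<in> H" if "f \<in> D" for f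
    using assms(2) that by (auto simp: densely_defined_operator_def)
  have dense: "\<exists>g\<in>D. nrm (f - g) < e" if "f \<in> H" "e > 0" for f e
    using assms(2) that by (auto simp: densely_defined_operator_def)
  have aff: "T (\<phi> * f) = \<phi> * T f" if "f \<in> D" "\<phi> \<in> Mult H" for f \<phi>
    using assms(3) that by (simp add: affiliated_to_Mult_def)
  have cross: "g x * T f x = f x * T g x" if f: "f \<in> D" and g: "g \<in> D" for f g x
  proof -
    obtain \<phi> \<psi> where 1: "\<phi> \<in> Mult H" "\<psi> \<in> Mult H" "\<And>x. \<psi> x \<noteq> 0" "\<phi> = \<psi> * f"
      using smirnov_quotient[OF DH[OF f]] by blast
    obtain \<phi>' \<psi>' where 2: "\<phi>' \<in> Mult H" "\<psi>' \<in> Mult H" "\<And>x. \<psi>' x \<noteq> 0" "\<phi>' = \<psi>' * g"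
      using smirnov_quotient[OF DH[OF g]] by blast
    have "(\<phi>' * \<psi>) * f = (\<phi> * \<psi>') * g" by (simp add: 1(4) 2(4) mult_ac)
    then have "(\<phi>' * \<psi>) * T f = (\<phi> * \<psi>') * T g"
      using aff[OF f Mult_mult[OF 2(1) 1(2)]] aff[OF g Mult_mult[OF 1(1) 2(2)]] by simp
    then have "\<psi>' x * \<psi> x * (g x * T f x) = \<psi>' x * \<psi> x * (f x * T g x)"
      by (simp add: 1(4) 2(4) fun_eq_iff mult_ac)
    then show ?thesis using 1(3) 2(3) by simp
  qed
  \<comment> \<open>Approximate \<open>ker x\<close> within less than its own norm: an
    \<open>f\<close> vanishing at \<open>x\<close> would be orthogonal to \<open>ker x\<close>,
    hence at least that far away.\<close>
  have "\<exists>f\<in>D. f x \<noteq> 0" for x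
  proof -
    have pos: "0 < Re (k x x)" by (rule k_diag)
    have self: "Re (k x x) = (nrm (ker x))\<^sup>2"
      using Re_ip_self[OF kernel_mem, of x] by (simp add: ker_ip)
    then have "nrm (ker x) > 0" using pos nrm_nonneg[OF kernel_mem, of x] by (cases "nrm (ker x) = 0") auto
    then obtain f where f: "f \<in> D" "nrm (ker x - f) < nrm (ker x)"
      using dense[OF kernel_mem] by blast
    have "f x \<noteq> 0"
    proof
      assume "f x = 0"
      then have "k x x = ip (ker x - f) (ker x)"
        using DH[OF f(1)] by (simp add: ip_diff_left kernel_mem ker_ip flip: reproducing)
      then have "Re (k x x) \<le> nrm (ker x - f) * nrm (ker x)"
        using cauchy_schwarz[OF mem_diff[OF kernel_mem DH[OF f(1)]] kernel_mem, of x x]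
          complex_Re_le_cmod[of "k x x"] by simp
      also have "\<dots> < nrm (ker x) * nrm (ker x)"
        using f(2) \<open>nrm (ker x) > 0\<close> by simp
      finally show False by (simp add: self power2_eq_square)
    qed
    with f show ?thesis by blast
  qed
  then obtain F where F: "\<And>x. F x \<in> D" "\<And>x. F x x \<noteq> 0" by metis
  define h where "h x = T (F x) x / F x x" for x
  have Th: "T f x = h x * f x" if "f \<in> D" for f x
    using cross[OF F(1)[of x] that, of x] F(2)[of x] by (simp add: h_def field_simps)
  \<comment> \<open>One \<open>f\<close> must serve both multipliers, so it is chosen with
    \<open>T f\<close> nonzero whenever possible.\<close>
  obtain f where f: "f \<in> D" "f \<noteq> 0" "(\<exists>f\<in>D. T f \<noteq> 0) \<Longrightarrow> T f \<noteq> 0"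
  proof (cases "\<exists>f\<in>D. T f \<noteq> 0")
    case True
    then obtain f where "f \<in> D" "T f \<noteq> 0" by blast
    moreover from this Th have "f \<noteq> 0" by (auto simp: fun_eq_iff)
    ultimately show thesis using that by blast
  next
    case False
    \<comment> \<open>Any point would do here; \<open>undefined\<close> merely names one.\<close>
    have "F undefined \<noteq> 0" using F(2)[of undefined] by (metis zero_fun_apply)
    with False F(1) show thesis using that by blast
  qed
  obtain \<phi> \<psi> where 1: "\<phi> \<in> Mult H" "\<psi> \<in> Mult H" "\<And>x. \<psi> x \<noteq> 0" "\<phi> = \<psi> * f"
    using smirnov_quotient[OF DH[OF f(1)]] by blast
  obtain \<phi>' \<psi>' where 2: "\<phi>' \<in> Mult H" "\<psi>' \<in> Mult H" "\<And>x. \<psi>' x \<noteq> 0" "\<phi>' = \<psi>' * T f"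
    using smirnov_quotient[OF TH[OF f(1)]] by blast
  \<comment> \<open>Clearing denominators gives \<open>a = \<psi>' * \<psi> * f\<close> and
    \<open>b = \<psi>' * \<psi> * T f\<close>, whose quotient is \<open>h\<close>; nowhere vanishing
    denominators keep them nonzero.\<close>
  have "\<psi>' * \<phi> \<in> Mult H" "\<psi> * \<phi>' \<in> Mult H"
    by (intro Mult_mult 1 2)+
  moreover have "\<psi>' * \<phi> \<noteq> 0" using f(2) 1(3) 2(3) by (auto simp: 1(4) fun_eq_iff)
  moreover have "\<psi> * \<phi>' \<noteq> 0" if "\<exists>f\<in>D. T f \<noteq> 0"
    using f(3)[OF that] 1(3) 2(3) by (auto simp: 2(4) fun_eq_iff)
  moreover have "\<forall>x. (\<psi> * \<phi>') x = (\<psi>' * \<phi>) x * h x"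
    by (simp add: 1(4) 2(4) Th[OF f(1)])
  ultimately show ?thesis using Th by blast
qed

end
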